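(* (i) There is no elliptic curve defined over $\mathbb{Q}$ having a Weierstrass equation with rational coefficients on which there is a simultaneous arithmetic progression of length $7$ consisting of points of $E(\mathbb{Q})$. (ii) Up to isomorphism over $\mathbb{Q}$, there are only finitely many elliptic curves $E$ over $\mathbb{Q}$ having a Weierstrass equation with rational coefficients on which there is a simultaneous arithmetic progression of length $6$ consisting of points of $E(\mathbb{Q})$.
   Context: A Weierstrass equation over $\mathbb{Q}$ is $Y^2+a_1XY+a_3Y=X^3+a_2X^2+a_4X+a_6$ with $a_i\in\mathbb{Q}$ (nonsingular). Points $P_0=(x_0,y_0),\dots,P_n=(x_n,y_n)$ on such an equation form a simultaneous arithmetic progression (s.a.p.) of length $n+1$ if (a) $x_0,\dots,x_n$ is an arithmetic progression with nonzero common difference, and (b) there is a permutation $\sigma$ of $\{0,\dots,n\}$ such that $y_{\sigma(0)},\dots,y_{\sigma(n)}$ is an arithmetic progression. The condition (b) depends on the particular Weierstrass equation chosen, so "a curve has a s.a.p." means that some Weierstrass equation of it does. *)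

theory Defs
  imports Complex_Main "HOL-Combinatorics.Permutations"
begin

datatype 'a weierstrass =
  Weierstrass (a1: 'a) (a2: 'a) (a3: 'a) (a4: 'a) (a6: 'a)

definition weierstrass_poly :: "'a::field weierstrass \<Rightarrow> 'a \<Rightarrow> 'a \<Rightarrow> 'a" where
  "weierstrass_poly W x y =
     y^2 + a1 W * x * y + a3 W * y - (x^3 + a2 W * x^2 + a4 W * x + a6 W)"

definition weierstrass_poly_dx :: "'a::field weierstrass \<Rightarrow> 'a \<Rightarrow> 'a \<Rightarrow> 'a" where
  "weierstrass_poly_dx W x y = a1 W * y - (3 * x^2 + 2 * a2 W * x + a4 W)"

definition weierstrass_poly_dy :: "'a::field weierstrass \<Rightarrow> 'a \<Rightarrow> 'a \<Rightarrow> 'a" where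
  "weierstrass_poly_dy W x y = 2 * y + a1 W * x + a3 W"

definition singular_point :: "'a::field weierstrass \<Rightarrow> 'a \<Rightarrow> 'a \<Rightarrow> bool" where
  "singular_point W x y \<longleftrightarrow>
     weierstrass_poly W x y = 0 \<and> weierstrass_poly_dx W x y = 0 \<and> weierstrass_poly_dy W x y = 0"

text \<open>An elliptic curve over the rationals is given by a rational Weierstrass equation without
  geometric singular points. Geometric points are taken in the algebraically closed field of
  complex numbers, to which the coefficients are mapped by \<^const>\<open>of_rat\<close>. Only affine points
  need to be tested: the point at infinity of a Weierstrass cubic is always smooth.\<close>

definition elliptic_curve :: "rat weierstrass \<Rightarrow> bool" where
  "elliptic_curve W \<longleftrightarrow>
     (\<nexists>x y :: complex. singular_point (map_weierstrass of_rat W) x y)"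

text \<open>Two Weierstrass equations over the rationals define isomorphic (pointed) curves iff an
  admissible change of variables takes one to the other. The identity below is one of polynomial
  functions, which over the rationals is the same as one of polynomials.\<close>

definition rat_isomorphic :: "rat weierstrass \<Rightarrow> rat weierstrass \<Rightarrow> bool" where
  "rat_isomorphic W W' \<longleftrightarrow>
     (\<exists>u r s t. u \<noteq> 0 \<and>
        (\<forall>x y. weierstrass_poly W (u^2 * x + r) (u^3 * y + s * u^2 * x + t)
               = u^6 * weierstrass_poly W' x y))"

definition rat_iso_rel :: "(rat weierstrass \<times> rat weierstrass) set" where
  "rat_iso_rel = {(W, W'). rat_isomorphic W W'}"

definition arith_prog :: "nat \<Rightarrow> (nat \<Rightarrow> rat) \<Rightarrow> rat \<Rightarrow> bool" where
  "arith_prog m f d \<longleftrightarrow> (\<forall>i. Suc i < m \<longrightarrow> f (Suc i) - f i = d)"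

text \<open>Here \<open>m\<close> is the number of points. As usual, only the common difference of the
  \<open>x\<close>-coordinates is required to be nonzero.\<close>

definition sap_on :: "rat weierstrass \<Rightarrow> nat \<Rightarrow> (nat \<Rightarrow> rat) \<Rightarrow> (nat \<Rightarrow> rat) \<Rightarrow> bool" where
  "sap_on W m x y \<longleftrightarrow>
     (\<forall>i<m. weierstrass_poly W (x i) (y i) = 0) \<and>
     (\<exists>d. d \<noteq> 0 \<and> arith_prog m x d) \<and>
     (\<exists>\<sigma> e. \<sigma> permutes {..<m} \<and> arith_prog m (y \<circ> \<sigma>) e)"

text \<open>The Weierstrass equations of a curve are those isomorphic to a given one.\<close>

definition has_sap :: "rat weierstrass \<Rightarrow> nat \<Rightarrow> bool" where
  "has_sap E m \<longleftrightarrow> (\<exists>W x y. rat_isomorphic E W \<and> sap_on W m x y)"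

lemma equiv_rat_iso_rel: "equiv UNIV rat_iso_rel"
proof (rule equivI)
  show "refl rat_iso_rel"
    unfolding refl_on_def rat_iso_rel_def rat_isomorphic_def mem_Collect_eq prod.case
    by (intro ballI exI[of _ "1::rat"] exI[of _ "0::rat"]) simp
  show "sym rat_iso_rel"
  proof (rule symI)
    fix W W' assume "(W, W') \<in> rat_iso_rel"
    then obtain u r s t where u: "u \<noteq> 0" and
      *: "\<And>x y. weierstrass_poly W (u^2 * x + r) (u^3 * y + s * u^2 * x + t)
                 = u^6 * weierstrass_poly W' x y"
      by (auto simp: rat_iso_rel_def rat_isomorphic_def)
    let ?v = "1 / u" and ?r = "- r / u^2" and ?s = "- s / u" and ?t = "(s * r - t) / u^3"
    have "weierstrass_poly W' (?v^2 * x + ?r) (?v^3 * y + ?s * ?v^2 * x + ?t)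
            = ?v^6 * weierstrass_poly W x y" for x y
    proof -
      have x: "u^2 * (?v^2 * x + ?r) + r = x"
        using u by (simp add: field_simps)
      have y: "u^3 * (?v^3 * y + ?s * ?v^2 * x + ?t) + s * u^2 * (?v^2 * x + ?r) + t = y"
        using u by (simp add: field_simps power2_eq_square power3_eq_cube)
      show ?thesis
        using *[of "?v^2 * x + ?r" "?v^3 * y + ?s * ?v^2 * x + ?t"] u
        unfolding x y by (simp add: power_one_over field_simps)
    qed
    then show "(W', W) \<in> rat_iso_rel"
      using u unfolding rat_iso_rel_def rat_isomorphic_def mem_Collect_eq prod.case
      by (intro exI[of _ ?v] exI[of _ ?r] exI[of _ ?s] exI[of _ ?t]) simp
  qed
  show "trans rat_iso_rel"
  proof (rule transI)
    fix W W' W'' assume "(W, W') \<in> rat_iso_rel" "(W', W'') \<in> rat_iso_rel"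
    then obtain u r s t v r' s' t' where u: "u \<noteq> 0" "v \<noteq> 0" and
      *: "\<And>x y. weierstrass_poly W (u^2 * x + r) (u^3 * y + s * u^2 * x + t)
                 = u^6 * weierstrass_poly W' x y"
         "\<And>x y. weierstrass_poly W' (v^2 * x + r') (v^3 * y + s' * v^2 * x + t')
                 = v^6 * weierstrass_poly W'' x y"
      unfolding rat_iso_rel_def rat_isomorphic_def mem_Collect_eq prod.case by metis
    let ?r = "u^2 * r' + r" and ?s = "u * s' + s" and ?t = "u^3 * t' + s * u^2 * r' + t"
    have "weierstrass_poly W ((u * v)^2 * x + ?r) ((u * v)^3 * y + ?s * (u * v)^2 * x + ?t)
            = (u * v)^6 * weierstrass_poly W'' x y" for x y
    proof -
      have x: "(u * v)^2 * x + ?r = u^2 * (v^2 * x + r') + r"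
        by (simp add: algebra_simps)
      have y: "(u * v)^3 * y + ?s * (u * v)^2 * x + ?t =
               u^3 * (v^3 * y + s' * v^2 * x + t') + s * u^2 * (v^2 * x + r') + t"
        by (simp add: algebra_simps power2_eq_square power3_eq_cube)
      show ?thesis
        unfolding x y * by (simp add: power_mult_distrib)
    qed
    then show "(W, W'') \<in> rat_iso_rel"
      using u unfolding rat_iso_rel_def rat_isomorphic_def mem_Collect_eq prod.case
      by (intro exI[of _ "u * v"] exI[of _ ?r] exI[of _ ?s] exI[of _ ?t]) simp
  qed
qed simp_all

end

theory Submission
  imports Defs
begin

text \<open>An admissible change of variables brings a progression to the points $(ci, c\tau(i))$ with
  $c \neq 0$ and $\tau$ a permutation of $\{0,\dots,n\}$. With $A = a_1$ and $B = a_3/c$ the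
  Weierstrass equation says that $\tau(i)^2 + A\,i\,\tau(i) + B\,\tau(i)$ is a cubic polynomial
  in $i$ with leading coefficient $c$. Its third differences equal $6c$ and its fourth differences
  vanish, which gives linear equations in $A$ and $B$. For seven points there are three fourth
  differences, and for each of the 5040 permutations the equations are inconsistent or force
  $c = 0$. For six points and each of the 720 permutations, the two fourth differences determine
  $A$ and $B$, hence the whole equation, unless the third differences already force $c = 0$.\<close>

section \<open>Normalisation of a progression\<close>

lemma arith_prog_nth:
  assumes "arith_prog m f d" "i < m"
  shows "f i = f 0 + of_nat i * d"
  using assms(2)
proof (induction i)
  case (Suc i)
  then have "f (Suc i) = f i + d"
    using assms(1) unfolding arith_prog_def by (metis add.commute diff_add_cancel)
  then show ?case using Suc by (simp add: algebra_simps)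
qed simp

text \<open>Admissible changes without shear: each coordinate is changed affinely by itself, so
  progressions in x and in y survive. The witness comes from comparing coefficients.\<close>

lemma weierstrass_translate_scale:
  fixes W :: "rat weierstrass"
  assumes u: "u \<noteq> 0"
  obtains W' where "\<And>x y. weierstrass_poly W (u^2 * x + r) (u^3 * y + t) = u^6 * weierstrass_poly W' x y"
proof
  let ?W' = "Weierstrass (a1 W / u) ((a2 W + 3 * r) / u^2) ((a3 W + r * a1 W + 2 * t) / u^3)
    ((a4 W - t * a1 W + 2 * r * a2 W + 3 * r^2) / u^4)
    ((a6 W + r * a4 W + r^2 * a2 W + r^3 - t * a3 W - t^2 - r * t * a1 W) / u^6)"
  show "weierstrass_poly W (u^2 * x + r) (u^3 * y + t) = u^6 * weierstrass_poly ?W' x y" for x y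
    using u unfolding weierstrass_poly_def
    by (simp add: field_simps power2_eq_square power3_eq_cube eval_nat_numeral)
qed

text \<open>One parameter \<open>c\<close> serves both coordinates, because scaling x by a square
  and y by the matching cube can make the two common differences equal.\<close>

definition normal_sap :: "nat \<Rightarrow> (nat \<Rightarrow> nat) \<Rightarrow> rat \<Rightarrow> rat weierstrass \<Rightarrow> bool" where
  "normal_sap m \<tau> c W \<longleftrightarrow> c \<noteq> 0 \<and>
     (\<forall>i<m. weierstrass_poly W (c * of_nat i) (c * of_nat (\<tau> i)) = 0)"

lemma sap_on_imp_normal_sap:
  assumes sap: "sap_on W m x y" and m: "4 \<le> m"
  obtains \<tau> c W' where "\<tau> permutes {..<m}" "rat_isomorphic W W'" "normal_sap m \<tau> c W'"
proof -
  obtain d \<sigma> e where on: "\<And>i. i < m \<Longrightarrow> weierstrass_poly W (x i) (y i) = 0"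
    and d: "d \<noteq> 0" "arith_prog m x d" and \<sigma>: "\<sigma> permutes {..<m}" "arith_prog m (y \<circ> \<sigma>) e"
    using sap unfolding sap_on_def by auto
  \<comment> \<open>The inverse permutation sends the index of a point in the x-progression to its
    rank in the y-progression.\<close>
  define \<tau> b where "\<tau> = inv \<sigma>" and "b = (y \<circ> \<sigma>) 0"
  have \<tau>: "\<tau> permutes {..<m}"
    unfolding \<tau>_def using \<sigma>(1) by (rule permutes_inv)
  have y: "y i = b + of_nat (\<tau> i) * e" if "i < m" for i
  proof -
    have "\<tau> i < m" using permutes_in_image[OF \<tau>, of i] that by simp
    from arith_prog_nth[OF \<sigma>(2) this] show ?thesis
      using permutes_inverses(1)[OF \<sigma>(1)] by (simp add: \<tau>_def b_def)
  qed
  have eq: "weierstrass_poly W (x 0 + of_nat i * d) (b + of_nat (\<tau> i) * e) = 0" if "i < m" for i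
    using on[OF that] arith_prog_nth[OF d(2) that] y[OF that] by simp
  have e: "e \<noteq> 0"
  proof
    \<comment> \<open>A line y = b would meet the curve in the four points of index 0, 1, 2, 3.\<close>
    assume "e = 0"
    then have p: "weierstrass_poly W (x 0 + of_nat i * d) b = 0" if "i < 4" for i
      using eq[of i] that m by simp
    \<comment> \<open>For fixed y the polynomial is a cubic in x with leading coefficient -1, so its
      third difference with step \<open>d\<close> is -6 d^3.\<close>
    have "- (6 * d^3) = weierstrass_poly W (x 0 + of_nat 3 * d) b
        - 3 * weierstrass_poly W (x 0 + of_nat 2 * d) b
        + 3 * weierstrass_poly W (x 0 + of_nat 1 * d) b
        - weierstrass_poly W (x 0 + of_nat 0 * d) b"
      unfolding weierstrass_poly_def
      by (simp add: algebra_simps power2_eq_square power3_eq_cube)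
    also have "\<dots> = 0" using p[of 0] p[of 1] p[of 2] p[of 3] by simp
    finally show False using d by simp
  qed
  \<comment> \<open>These values solve u^2 c = d and u^3 c = e.\<close>
  define u c where "u = e / d" and "c = d^3 / e^2"
  have u: "u \<noteq> 0" and c: "c \<noteq> 0" and scale: "u^2 * c = d" "u^3 * c = e"
    using d e by (simp_all add: u_def c_def power_divide power2_eq_square power3_eq_cube)
  obtain W' where W': "\<And>X Y. weierstrass_poly W (u^2 * X + x 0) (u^3 * Y + b)
      = u^6 * weierstrass_poly W' X Y"
    using weierstrass_translate_scale[OF u] by blast
  have "weierstrass_poly W' (c * of_nat i) (c * of_nat (\<tau> i)) = 0" if "i < m" for i
  proof -
    have XY: "u^2 * (c * of_nat i) + x 0 = x 0 + of_nat i * d"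
      "u^3 * (c * of_nat (\<tau> i)) + b = b + of_nat (\<tau> i) * e"
      by (simp_all add: mult.assoc[symmetric] scale)
    show ?thesis
      using W'[of "c * of_nat i" "c * of_nat (\<tau> i)"] eq[OF that] u unfolding XY by simp
  qed
  then have "normal_sap m \<tau> c W'" using c by (simp add: normal_sap_def)
  moreover have "rat_isomorphic W W'"
    unfolding rat_isomorphic_def using u W'
    by (intro exI[of _ u] exI[of _ "x 0"] exI[of _ 0] exI[of _ b]) simp
  ultimately show thesis using \<tau> that by blast
qed

section \<open>Linear forms and their differences\<close>

text \<open>The triple $(p, q, r)$ stands for the affine form $p + qA + rB$.\<close>

type_synonym form = "int \<times> int \<times> int"

fun form_value :: "rat \<Rightarrow> rat \<Rightarrow> form \<Rightarrow> rat" where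
  "form_value A B (p, q, r) = of_int p + of_int q * A + of_int r * B"

fun det3 :: "form \<Rightarrow> form \<Rightarrow> form \<Rightarrow> int" where
  "det3 (p, q, r) (p', q', r') (p'', q'', r'') =
     p * (q' * r'' - q'' * r') + p' * (q'' * r - q * r'') + p'' * (q * r' - q' * r)"

fun minor :: "form \<Rightarrow> form \<Rightarrow> int" where
  "minor (p, q, r) (p', q', r') = q * r' - q' * r"

text \<open>An entry y at index i yields y^2 + i y A + y B: the left side of the normalised equation
  divided by c^2.\<close>

fun forms :: "int \<Rightarrow> int list \<Rightarrow> form list" where
  "forms i [] = []"
| "forms i (y # ys) = (y * y, i * y, y) # forms (i + 1) ys"

fun diffs :: "form list \<Rightarrow> form list" where
  "diffs ((p, q, r) # (p', q', r') # vs) = (p' - p, q' - q, r' - r) # diffs ((p', q', r') # vs)"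
| "diffs _ = []"

lemma length_diffs: "length (diffs vs) = length vs - 1"
  by (induction vs rule: diffs.induct) auto

lemma form_value_diffs:
  assumes "Suc i < length vs"
  shows "form_value A B (diffs vs ! i) = form_value A B (vs ! Suc i) - form_value A B (vs ! i)"
  using assms
proof (induction vs arbitrary: i rule: diffs.induct)
  case (1 p q r p' q' r' vs)
  then show ?case by (cases i) (auto simp: algebra_simps)
qed auto

lemma forms_nth:
  "i < length ys \<Longrightarrow> forms k ys ! i = (ys ! i * ys ! i, (k + int i) * ys ! i, ys ! i)"
proof (induction ys arbitrary: i k)
  case (Cons y ys)
  then show ?case by (cases i) (auto simp: algebra_simps)
qed simp

lemma length_forms: "length (forms k ys) = length ys"
  by (induction ys arbitrary: k) auto

text \<open>Adding A times the second column and B times the third to the first turns that column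
  into the values of the forms; expanding along it leaves one term.\<close>

lemma form_value_det3:
  assumes "form_value A B v = 0" "form_value A B w = 0"
  shows "of_int (det3 u v w) = form_value A B u * of_int (minor v w)"
proof -
  obtain p q r p' q' r' p'' q'' r'' where
    eq: "u = (p, q, r)" "v = (p', q', r')" "w = (p'', q'', r'')"
    by (metis prod_cases3)
  have p: "rat_of_int p' = - (of_int q' * A + of_int r' * B)"
    "rat_of_int p'' = - (of_int q'' * A + of_int r'' * B)"
    using assms by (simp_all add: eq algebra_simps add_eq_0_iff)
  show ?thesis unfolding eq by (simp add: p) (simp add: algebra_simps)
qed

text \<open>Cramer's rule: (A - A', B - B') solves a homogeneous system with determinant
  \<open>minor v w\<close>.\<close>

lemma form_value_inj:
  assumes "form_value A B v = 0" "form_value A B w = 0"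
    and "form_value A' B' v = 0" "form_value A' B' w = 0"
    and "minor v w \<noteq> 0"
  shows "A = A'" "B = B'"
proof -
  obtain p' q' r' p'' q'' r'' where eq: "v = (p', q', r')" "w = (p'', q'', r'')"
    by (metis prod_cases3)
  have m: "rat_of_int (minor v w) \<noteq> 0" using assms(5) by simp
  have "of_int (minor v w) * (A - A')
      = of_int r'' * (form_value A B v - form_value A' B' v)
        - of_int r' * (form_value A B w - form_value A' B' w)"
    by (simp add: eq algebra_simps)
  then show "A = A'" using assms m by simp
  have "of_int (minor v w) * (B - B')
      = of_int q' * (form_value A B w - form_value A' B' w)
        - of_int q'' * (form_value A B v - form_value A' B' v)"
    by (simp add: eq algebra_simps)
  then show "B = B'" using assms m by simp
qed

definition third_diffs :: "int list \<Rightarrow> form list" where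
  "third_diffs ys = diffs (diffs (diffs (forms 0 ys)))"

text \<open>Divide the equation by c^2. The lower coefficients stay anonymous, since three
  differences remove them.\<close>

lemma form_value_forms:
  assumes "normal_sap m \<tau> c W"
  obtains k2 k1 k0 where "\<And>i. i < m \<Longrightarrow>
    form_value (a1 W) (a3 W / c) (forms 0 (map (int \<circ> \<tau>) [0..<m]) ! i)
      = c * of_nat i ^ 3 + k2 * of_nat i ^ 2 + k1 * of_nat i + k0"
proof
  fix i assume "i < m"
  moreover from this have "c \<noteq> 0" "weierstrass_poly W (c * of_nat i) (c * of_nat (\<tau> i)) = 0"
    using assms by (auto simp: normal_sap_def)
  ultimately show "form_value (a1 W) (a3 W / c) (forms 0 (map (int \<circ> \<tau>) [0..<m]) ! i)
      = c * of_nat i ^ 3 + a2 W * of_nat i ^ 2 + a4 W / c * of_nat i + a6 W / c ^ 2"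
    unfolding weierstrass_poly_def
    by (simp add: forms_nth field_simps power2_eq_square power3_eq_cube)
qed

lemma form_value_third_diffs:
  fixes c :: rat
  assumes "normal_sap m \<tau> c W" "v \<in> set (third_diffs (map (int \<circ> \<tau>) [0..<m]))"
  shows "form_value (a1 W) (a3 W / c) v = 6 * c"
proof -
  obtain i where "i < length (third_diffs (map (int \<circ> \<tau>) [0..<m]))"
    "v = third_diffs (map (int \<circ> \<tau>) [0..<m]) ! i"
    using assms(2) by (metis in_set_conv_nth)
  moreover obtain k2 k1 k0 where "\<And>i. i < m \<Longrightarrow>
    form_value (a1 W) (a3 W / c) (forms 0 (map (int \<circ> \<tau>) [0..<m]) ! i)
      = c * of_nat i ^ 3 + k2 * of_nat i ^ 2 + k1 * of_nat i + k0"
    using form_value_forms[OF assms(1)] by blast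
  ultimately show ?thesis
    by (simp add: third_diffs_def form_value_diffs length_diffs length_forms
        algebra_simps power2_eq_square power3_eq_cube)
qed

lemma form_value_fourth_diffs:
  assumes "normal_sap m \<tau> c W" "v \<in> set (diffs (third_diffs (map (int \<circ> \<tau>) [0..<m])))"
  shows "form_value (a1 W) (a3 W / c) v = 0"
proof -
  let ?vs = "third_diffs (map (int \<circ> \<tau>) [0..<m])"
  obtain i where "i < length (diffs ?vs)" "v = diffs ?vs ! i"
    using assms(2) by (metis in_set_conv_nth)
  then show ?thesis
    using form_value_third_diffs[OF assms(1)] by (simp add: form_value_diffs length_diffs)
qed

section \<open>Enumeration of the permutations\<close>

text \<open>Nested conditionals instead of disjunctions let the simplifier skip the later tests.\<close>

fun check7 :: "form list \<Rightarrow> form list \<Rightarrow> bool" where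
  "check7 (c # c' # _) [u, v, w] =
     (if det3 u v w \<noteq> 0 then True
      else if minor u v \<noteq> 0 then det3 c u v = 0
      else if c = (0, 0, 0) then True
      else if c' = (0, 0, 0) then True
      else minor v w \<noteq> 0 \<and> det3 c v w = 0)"
| "check7 _ _ = False"

text \<open>Either the fourth differences \<open>u\<close>, \<open>v\<close> have exactly one common
  zero, or a third difference vanishes identically and cannot take the value 6c.\<close>

fun check6 :: "form list \<Rightarrow> form list \<Rightarrow> bool" where
  "check6 (c # c' # _) [u, v] =
     (if minor u v \<noteq> 0 then True else c = (0, 0, 0) \<or> c' = (0, 0, 0))"
| "check6 _ _ = False"

definition perm_check7 :: "int list \<Rightarrow> bool" where
  "perm_check7 ys = check7 (third_diffs ys) (diffs (third_diffs ys))"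

definition perm_check6 :: "int list \<Rightarrow> bool" where
  "perm_check6 ys = check6 (third_diffs ys) (diffs (third_diffs ys))"

fun all_perms :: "nat \<Rightarrow> ('a list \<Rightarrow> bool) \<Rightarrow> 'a list \<Rightarrow> 'a list \<Rightarrow> bool" where
  "all_perms 0 P acc xs = P acc"
| "all_perms (Suc n) P acc xs = list_all (\<lambda>v. all_perms n P (v # acc) (remove1 v xs)) xs"

text \<open>Each chosen element goes to the front of \<open>acc\<close>, so the branch that selects
  \<open>ys\<close> in order ends at the reversed list.\<close>

lemma all_permsD:
  assumes "all_perms n P acc xs" "mset ys = mset xs" "length xs = n"
  shows "P (rev ys @ acc)"
  using assms
proof (induction n P acc xs arbitrary: ys rule: all_perms.induct)
  case (2 n P acc xs)
  then obtain v zs where ys: "ys = v # zs"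
    by (cases ys) auto
  have v: "v \<in> set xs"
    using 2(3) ys by (metis list.set_intros(1) mset_eq_setD)
  have "mset zs = mset (remove1 v xs)"
    using 2(3) by (simp add: ys flip: 2(3))
  then show ?case
    using "2.IH"[OF v, of zs] 2(2,4) v by (simp add: ys list_all_iff length_remove1)
qed simp

lemma permutes_all_perms:
  assumes "\<tau> permutes {..<m}" "all_perms m P [] (map int [0..<m])"
  shows "P (map (int \<circ> \<tau>) [0..<m])"
proof -
  \<comment> \<open>Starting from the reversed list cancels the reversal made by the
    enumeration.\<close>
  have "mset (rev (map (int \<circ> \<tau>) [0..<m])) = image_mset int (image_mset \<tau> (mset_set {..<m}))"
    by (simp add: multiset.map_comp lessThan_atLeast0)
  also have "image_mset \<tau> (mset_set {..<m}) = mset_set {..<m}"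
    using assms(1) by (simp add: image_mset_mset_set permutes_inj_on permutes_image)
  also have "image_mset int (mset_set {..<m}) = mset (map int [0..<m])"
    by (simp add: lessThan_atLeast0)
  finally have "mset (rev (map (int \<circ> \<tau>) [0..<m])) = mset (map int [0..<m])" .
  from all_permsD[OF assms(2) this] show ?thesis by simp
qed

lemma all_perms_check6: "all_perms 6 perm_check6 [] (map int [0..<6])"
  by code_simp

lemma all_perms_check7: "all_perms 7 perm_check7 [] (map int [0..<7])"
  by code_simp

section \<open>Six and seven points\<close>

text \<open>Every branch of \<open>check7\<close> contradicts the values at (A, B): the fourth
  differences vanish there, while the third differences equal 6c and are nonzero.\<close>

lemma no_normal_sap_7:
  assumes \<tau>: "\<tau> permutes {..<7}"
  shows "\<not> normal_sap 7 \<tau> c W"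
proof
  assume N: "normal_sap 7 \<tau> c W"
  let ?A = "a1 W" and ?B = "a3 W / c" and ?cs = "third_diffs (map (int \<circ> \<tau>) [0..<7])"
  have "check7 ?cs (diffs ?cs)"
    using permutes_all_perms[OF \<tau> all_perms_check7] by (simp add: perm_check7_def)
  then show False
  proof (cases rule: check7.elims(2))
    case (1 k k' ks u v w)
    have "c \<noteq> 0" using N by (simp add: normal_sap_def)
    then have k: "form_value ?A ?B k \<noteq> 0" "form_value ?A ?B k' \<noteq> 0"
      using form_value_third_diffs[OF N] 1(1) by simp_all
    have 0: "form_value ?A ?B u = 0" "form_value ?A ?B v = 0" "form_value ?A ?B w = 0"
      using form_value_fourth_diffs[OF N] 1(2) by simp_all
    \<comment> \<open>Three forms with a common zero have determinant 0; replacing one by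
      \<open>k\<close> gives 6c times the minor of the other two.\<close>
    have "det3 u v w = 0" "minor u v \<noteq> 0 \<Longrightarrow> det3 k u v \<noteq> 0" "minor v w \<noteq> 0 \<Longrightarrow> det3 k v w \<noteq> 0"
      using form_value_det3[OF 0(2,3), of u] form_value_det3[OF 0(1,2), of k]
        form_value_det3[OF 0(2,3), of k] 0(1) k(1) by auto
    then show False using 1(3) k by (auto split: if_splits)
  qed
qed

text \<open>The fourth differences fix A and B, a third difference then fixes c, and the points of
  index 0, 1, 2 fix the other coefficients.\<close>

lemma normal_sap_6_unique:
  assumes \<tau>: "\<tau> permutes {..<6}" and N: "normal_sap 6 \<tau> c W" and N': "normal_sap 6 \<tau> c' W'"
  shows "W = W'"
proof -
  let ?cs = "third_diffs (map (int \<circ> \<tau>) [0..<6])"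
  have "check6 ?cs (diffs ?cs)"
    using permutes_all_perms[OF \<tau> all_perms_check6] by (simp add: perm_check6_def)
  then show ?thesis
  proof (cases rule: check6.elims(2))
    case (1 k k' ks u v)
    have c: "c \<noteq> 0" "c' \<noteq> 0" using N N' by (simp_all add: normal_sap_def)
    have k: "form_value (a1 W) (a3 W / c) k = 6 * c" "form_value (a1 W) (a3 W / c) k' = 6 * c"
      "form_value (a1 W') (a3 W' / c') k = 6 * c'"
      using form_value_third_diffs[OF N] form_value_third_diffs[OF N'] 1(1) by simp_all
    have "k \<noteq> (0, 0, 0)" "k' \<noteq> (0, 0, 0)" using k c by auto
    then have minor: "minor u v \<noteq> 0" using 1(3) by (auto split: if_splits)
    have "form_value (a1 W) (a3 W / c) u = 0" "form_value (a1 W) (a3 W / c) v = 0"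
      "form_value (a1 W') (a3 W' / c') u = 0" "form_value (a1 W') (a3 W' / c') v = 0"
      using form_value_fourth_diffs[OF N] form_value_fourth_diffs[OF N'] 1(2) by simp_all
    note eqs = form_value_inj[OF this minor]
    have cc: "c = c'" using k eqs by simp
    have a13: "a1 W = a1 W'" "a3 W = a3 W'" using eqs cc c by simp_all
    have p: "weierstrass_poly W (c * of_nat i) (c * of_nat (\<tau> i))
        = weierstrass_poly W' (c * of_nat i) (c * of_nat (\<tau> i))" if "i < 6" for i
      using N N' that cc by (simp add: normal_sap_def)
    have a6: "a6 W = a6 W'"
      using p[of 0] a13 by (simp add: weierstrass_poly_def)
    \<comment> \<open>The equations at indices 1 and 2 are independent in (a2 W - a2 W') c^2 and (a4
      W - a4 W') c, so both vanish.\<close>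
    have "(a2 W - a2 W') * c^2 = - (a4 W - a4 W') * c"
      "4 * (a2 W - a2 W') * c^2 = - 2 * (a4 W - a4 W') * c"
      using p[of 1] p[of 2] a13 a6
      by (simp_all add: weierstrass_poly_def algebra_simps power2_eq_square)
    then have "(a2 W - a2 W') * c^2 = 0" "(a4 W - a4 W') * c = 0" by linarith+
    then have "a2 W = a2 W'" "a4 W = a4 W'" using c by simp_all
    then show ?thesis using a13 a6 by (simp add: weierstrass.expand)
  qed
qed

lemma finite_normal_sap_6: "finite {W. \<exists>\<tau> c. \<tau> permutes {..<6} \<and> normal_sap 6 \<tau> c W}"
proof -
  have "finite {W. \<exists>c. normal_sap 6 \<tau> c W}" if \<tau>: "\<tau> permutes {..<6}" for \<tau>
  proof (cases "\<exists>W c. normal_sap 6 \<tau> c W")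
    case True
    then obtain W c where "normal_sap 6 \<tau> c W" by blast
    then have "{W. \<exists>c. normal_sap 6 \<tau> c W} \<subseteq> {W}" using normal_sap_6_unique[OF \<tau>] by blast
    then show ?thesis by (rule finite_subset) simp
  qed simp
  then have "finite (\<Union>\<tau>\<in>{\<tau>. \<tau> permutes {..<6}}. {W. \<exists>c. normal_sap 6 \<tau> c W})"
    by (simp add: finite_permutations)
  also have "(\<Union>\<tau>\<in>{\<tau>. \<tau> permutes {..<6}}. {W. \<exists>c. normal_sap 6 \<tau> c W})
      = {W. \<exists>\<tau> c. \<tau> permutes {..<6} \<and> normal_sap 6 \<tau> c W}" by blast
  finally show ?thesis .
qed

lemma has_sap_imp_normal_sap:
  assumes "has_sap E m" "4 \<le> m"
  obtains \<tau> c W where "\<tau> permutes {..<m}" "(E, W) \<in> rat_iso_rel" "normal_sap m \<tau> c W"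
proof -
  obtain W x y where W: "rat_isomorphic E W" "sap_on W m x y"
    using assms(1) by (auto simp: has_sap_def)
  obtain \<tau> c W' where "\<tau> permutes {..<m}" "rat_isomorphic W W'" "normal_sap m \<tau> c W'"
    using sap_on_imp_normal_sap[OF W(2) assms(2)] .
  moreover from this W(1) have "(E, W') \<in> rat_iso_rel"
    using equiv_rat_iso_rel by (auto simp: rat_iso_rel_def equiv_def dest: transD)
  ultimately show thesis using that by blast
qed

theorem theorem3:
  shows "\<not> (\<exists>E. elliptic_curve E \<and> has_sap E 7) \<and>
    finite ({E. elliptic_curve E \<and> has_sap E 6} // rat_iso_rel)"
proof
  show "\<not> (\<exists>E. elliptic_curve E \<and> has_sap E 7)"
  proof
    assume "\<exists>E. elliptic_curve E \<and> has_sap E 7"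
    then obtain E where "has_sap E 7" by blast
    then obtain \<tau> c W where "\<tau> permutes {..<7}" "normal_sap 7 \<tau> c W"
      by (rule has_sap_imp_normal_sap) auto
    then show False using no_normal_sap_7 by blast
  qed
  \<comment> \<open>Every class contains a normalised equation, hence is the class of a member of a
    finite set.\<close>
  have "{E. elliptic_curve E \<and> has_sap E 6} // rat_iso_rel
      \<subseteq> (\<lambda>W. rat_iso_rel `` {W}) ` {W. \<exists>\<tau> c. \<tau> permutes {..<6} \<and> normal_sap 6 \<tau> c W}"
  proof
    fix K assume "K \<in> {E. elliptic_curve E \<and> has_sap E 6} // rat_iso_rel"
    then obtain E where E: "has_sap E 6" "K = rat_iso_rel `` {E}"
      by (auto elim: quotientE)
    obtain \<tau> c W where "\<tau> permutes {..<6}" "(E, W) \<in> rat_iso_rel" "normal_sap 6 \<tau> c W"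
      using E(1) by (rule has_sap_imp_normal_sap) auto
    moreover from this have "K = rat_iso_rel `` {W}"
      using E(2) equiv_class_eq[OF equiv_rat_iso_rel] by simp
    ultimately show "K \<in> (\<lambda>W. rat_iso_rel `` {W}) ` {W. \<exists>\<tau> c. \<tau> permutes {..<6} \<and> normal_sap 6 \<tau> c W}"
      by blast
  qed
  then show "finite ({E. elliptic_curve E \<and> has_sap E 6} // rat_iso_rel)"
    using finite_normal_sap_6 by (rule finite_surj[rotated])
qed

end
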